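(* Let $K_1,\ldots,K_m$ be consistent propositional formulae whose set of maxsets, seen as a hypergraph with vertex set $\{K_1,\ldots,K_m\}$, is Berge-acyclic. Then the disjunction of every nonempty subset of the set of maxsets is obtainable by priority base merging from $K_1,\ldots,K_m$.
   Context: A maxset of $K_1,\ldots,K_m$ is a maximal (under inclusion) consistent subset $M\subseteq\{K_1,\ldots,K_m\}$; in a disjunction, a maxset stands for the conjunction of its formulae. A hypergraph is Berge-acyclic if there is no sequence $(E_1,v_1,E_2,v_2,\ldots,E_n,v_n)$ with $n\geq 2$, distinct hyperedges $E_1,\dots,E_n$ and distinct vertices $v_1,\dots,v_n$ such that $v_i\in E_i\cap E_{i+1}$ for $i<n$ and $v_n\in E_n\cap E_1$. A priority ordering is an ordered partition $P(1),P(2),\ldots,P(k)$ of $\{K_1,\ldots,K_m\}$ into nonempty classes. For $L,N\subseteq\{K_1,\ldots,K_m\}$, $L<N$ iff there is $i$ such that $P(j)\cap L=P(j)\cap N$ for all $j<i$ and $P(i)\cap L\supsetneq P(i)\cap N$. The result of (priority base) merging with $P$ is the disjunction of all maxsets $M$ that are minimal, i.e. such that no maxset $N$ satisfies $N<M$. A formula $R$ is obtainable from $K_1,\ldots,K_m$ if it is equivalent to the result of merging with some priority ordering. *)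

theory Defs
  imports Main "HOL-Library.Disjoint_Sets"
begin

datatype 'a form =
    Bot
  | Var 'a
  | Neg "'a form"
  | And "'a form" "'a form"
  | Or "'a form" "'a form"

primrec sat :: "('a \<Rightarrow> bool) \<Rightarrow> 'a form \<Rightarrow> bool" where
  "sat v Bot \<longleftrightarrow> False"
| "sat v (Var x) \<longleftrightarrow> v x"
| "sat v (Neg F) \<longleftrightarrow> \<not> sat v F"
| "sat v (And F G) \<longleftrightarrow> sat v F \<and> sat v G"
| "sat v (Or F G) \<longleftrightarrow> sat v F \<or> sat v G"

definition equivalent :: "'a form \<Rightarrow> 'a form \<Rightarrow> bool" where
  "equivalent F G \<longleftrightarrow> (\<forall>v. sat v F \<longleftrightarrow> sat v G)"

definition consistent :: "'a form set \<Rightarrow> bool" where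
  "consistent S \<longleftrightarrow> (\<exists>v. \<forall>F\<in>S. sat v F)"

(* Conjunction and disjunction of a finite set of formulae; the order in which the
   members are listed is arbitrary and irrelevant up to equivalence. *)

definition Conj :: "'a form set \<Rightarrow> 'a form" where
  "Conj S = foldr And (SOME Fs. set Fs = S \<and> distinct Fs) (Neg Bot)"

definition Disj :: "'a form set \<Rightarrow> 'a form" where
  "Disj S = foldr Or (SOME Fs. set Fs = S \<and> distinct Fs) Bot"

lemma sat_Conj: "finite S \<Longrightarrow> sat v (Conj S) \<longleftrightarrow> (\<forall>F\<in>S. sat v F)"
proof -
  assume "finite S"
  then have "set (SOME Fs. set Fs = S \<and> distinct Fs) = S"
    using someI_ex[OF finite_distinct_list] by blast
  moreover have "sat v (foldr And Fs (Neg Bot)) \<longleftrightarrow> (\<forall>F\<in>set Fs. sat v F)" for Fs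
    by (induction Fs) auto
  ultimately show ?thesis by (simp add: Conj_def)
qed

lemma sat_Disj: "finite S \<Longrightarrow> sat v (Disj S) \<longleftrightarrow> (\<exists>F\<in>S. sat v F)"
proof -
  assume "finite S"
  then have "set (SOME Fs. set Fs = S \<and> distinct Fs) = S"
    using someI_ex[OF finite_distinct_list] by blast
  moreover have "sat v (foldr Or Fs Bot) \<longleftrightarrow> (\<exists>F\<in>set Fs. sat v F)" for Fs
    by (induction Fs) auto
  ultimately show ?thesis by (simp add: Disj_def)
qed

definition maxsets :: "'a form set \<Rightarrow> 'a form set set" where
  "maxsets KS = {M. M \<subseteq> KS \<and> consistent M \<and>
                    (\<forall>N. N \<subseteq> KS \<and> consistent N \<and> M \<subseteq> N \<longrightarrow> N = M)}"

(* In a disjunction, a maxset stands for the conjunction of its formulae. *)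
definition disj_maxsets :: "'a form set set \<Rightarrow> 'a form" where
  "disj_maxsets S = Disj (Conj ` S)"

(* A hypergraph is given by its set of hyperedges H.  In a Berge cycle the vertex
   vs ! i links Es ! i with the next hyperedge; the last vertex links back to Es ! 0. *)

definition berge_cycle :: "'b set set \<Rightarrow> 'b set list \<Rightarrow> 'b list \<Rightarrow> bool" where
  "berge_cycle H Es vs \<longleftrightarrow>
     length Es \<ge> 2 \<and> length vs = length Es \<and>
     set Es \<subseteq> H \<and> distinct Es \<and> distinct vs \<and>
     (\<forall>i. Suc i < length Es \<longrightarrow> vs ! i \<in> Es ! i \<inter> Es ! Suc i) \<and>
     last vs \<in> last Es \<inter> hd Es"

definition berge_acyclic :: "'b set set \<Rightarrow> bool" where
  "berge_acyclic H \<longleftrightarrow> \<not> (\<exists>Es vs. berge_cycle H Es vs)"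

(* The class P(i) of an ordered partition is P ! (i - 1). *)

definition priority_ordering :: "'b set \<Rightarrow> 'b set list \<Rightarrow> bool" where
  "priority_ordering KS P \<longleftrightarrow> distinct P \<and> partition_on KS (set P)"

definition prio_less :: "'b set list \<Rightarrow> 'b set \<Rightarrow> 'b set \<Rightarrow> bool" where
  "prio_less P L N \<longleftrightarrow>
     (\<exists>i<length P. (\<forall>j<i. P ! j \<inter> L = P ! j \<inter> N) \<and> P ! i \<inter> L \<supset> P ! i \<inter> N)"

definition merge :: "'a form set \<Rightarrow> 'a form set list \<Rightarrow> 'a form" where
  "merge KS P =
     disj_maxsets {M \<in> maxsets KS. \<not> (\<exists>N \<in> maxsets KS. prio_less P N M)}"

definition obtainable :: "'a form set \<Rightarrow> 'a form \<Rightarrow> bool" where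
  "obtainable KS R \<longleftrightarrow> (\<exists>P. priority_ordering KS P \<and> equivalent R (merge KS P))"

end

(* Ordered partitions into classes amount to rank functions r on the formulae, with L < N iff for
   some i the formulae of rank at most i in N form a proper subset of those in L. A Berge-acyclic
   hypergraph with at least two edges has an ear: an edge E such that, for some other edge N',
   the vertices in E - N' lie in no edge but E; the end of a longest Berge path is one. If S = {E},
   put E before everything else. Otherwise, by induction, some r selects S - {E} from the other
   edges, and it suffices to choose one new rank for all the private vertices E - N'. If E is not
   in S, take a rank so large that N' beats E. If E is in S, take the least i such that no edge in
   S - {E} has all its vertices of rank at most i inside E: below i, E can only beat an edge that
   N' beats and only be beaten by an edge that beats an edge in S; from i on, the private vertices
   make E incomparable to the edges in S. *)

theory Submission
  imports Defs
begin

section \<open>Ears of Berge-acyclic hypergraphs\<close>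

lemma berge_acyclic_subset: "berge_acyclic H \<Longrightarrow> H' \<subseteq> H \<Longrightarrow> berge_acyclic H'"
  unfolding berge_acyclic_def berge_cycle_def by (meson subset_trans)

text \<open>Indexed as in \<open>berge_cycle\<close>, but without the closing vertex, so that a
  single edge with no vertices counts as a path.\<close>

definition berge_path :: "'b set set \<Rightarrow> 'b set list \<Rightarrow> 'b list \<Rightarrow> bool" where
  "berge_path H Es vs \<longleftrightarrow>
     length Es = Suc (length vs) \<and> set Es \<subseteq> H \<and> distinct Es \<and> distinct vs \<and>
     (\<forall>i<length vs. vs ! i \<in> Es ! i \<inter> Es ! Suc i)"

lemma berge_path_Cons:
  assumes "berge_path H Es vs" "M \<in> H" "M \<notin> set Es" "x \<notin> set vs" "x \<in> M" "x \<in> Es ! 0"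
  shows "berge_path H (M # Es) (x # vs)"
  using assms unfolding berge_path_def by (auto simp: nth_Cons split: nat.splits)

text \<open>The cycle follows the path up to \<open>Es ! k\<close> and returns to
  \<open>Es ! 0\<close> through \<open>x\<close>; \<open>0 < k\<close> supplies the two edges that a
  cycle needs.\<close>

lemma berge_path_closes:
  assumes p: "berge_path H Es vs" and k: "0 < k" "k < length Es"
    and x: "x \<in> Es ! 0" "x \<in> Es ! k" "x \<notin> set (take k vs)"
  shows "berge_cycle H (take (Suc k) Es) (take k vs @ [x])"
proof -
  have l: "length Es = Suc (length vs)" and s: "set Es \<subseteq> H" "distinct Es" "distinct vs"
    and i: "\<And>i. i < length vs \<Longrightarrow> vs ! i \<in> Es ! i \<inter> Es ! Suc i"
    using p by (auto simp: berge_path_def)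
  have kl: "k \<le> length vs" using k l by simp
  have "last (take (Suc k) Es) = Es ! k"
    using k by (simp add: take_Suc_conv_app_nth)
  moreover have "hd (take (Suc k) Es) = Es ! 0"
    using l by (cases Es) auto
  moreover have "set (take (Suc k) Es) \<subseteq> H"
    by (rule order_trans[OF set_take_subset s(1)])
  moreover have "(take k vs @ [x]) ! j \<in> take (Suc k) Es ! j \<inter> take (Suc k) Es ! Suc j"
    if "Suc j < length (take (Suc k) Es)" for j
    using that i[of j] kl l by (simp add: nth_append)
  ultimately show ?thesis
    using l s x k kl unfolding berge_cycle_def by simp
qed

lemma berge_acyclic_ear:
  assumes fin: "finite H" and ac: "berge_acyclic H" and two: "A \<in> H" "B \<in> H" "A \<noteq> B"
  obtains E N where "E \<in> H" "N \<in> H" "N \<noteq> E" "\<And>M. M \<in> H \<Longrightarrow> M \<noteq> E \<Longrightarrow> E \<inter> M \<subseteq> N"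
proof -
  define path where "path Es \<longleftrightarrow> (\<exists>vs. berge_path H Es vs)" for Es
  have "path [A]"
    unfolding path_def berge_path_def using two by (intro exI[of _ "[]"]) auto
  \<comment> \<open>The edges of a path are distinct, so path lengths are bounded and a longest path
    exists. Its first edge will be the ear.\<close>
  moreover have "length Es \<le> card H" if "path Es" for Es
    using that fin by (metis path_def berge_path_def card_mono distinct_card)
  ultimately obtain Es where Es: "path Es" and longest: "\<And>Fs. path Fs \<Longrightarrow> length Fs \<le> length Es"
    using ex_has_greatest_nat[of path "[A]" length "Suc (card H)"]
    by (auto simp: less_Suc_eq_le)
  then obtain vs where p: "berge_path H Es vs" by (auto simp: path_def)
  have l: "length Es = Suc (length vs)" and s: "set Es \<subseteq> H" "distinct Es" "distinct vs"
    and i: "\<And>i. i < length vs \<Longrightarrow> vs ! i \<in> Es ! i \<inter> Es ! Suc i"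
    using p by (auto simp: berge_path_def)
  \<comment> \<open>A vertex shared by the first edge and a later one closes a cycle unless it
    already links two earlier edges.\<close>
  have no_cycle: "x \<in> set (take k vs)"
    if "0 < k" "k < length Es" "x \<in> Es ! 0" "x \<in> Es ! k" for x k
    using berge_path_closes[OF p that] ac by (auto simp: berge_acyclic_def)
  have E: "Es ! 0 \<in> H" using s(1) l by (metis nth_mem subsetD zero_less_Suc)
  \<comment> \<open>Otherwise \<open>M\<close> could be prepended through \<open>x\<close>, giving a
    longer path.\<close>
  have in_path: "M \<in> set Es" if "M \<in> H" "x \<in> M" "x \<in> Es ! 0" "x \<notin> set vs" for M x
    using berge_path_Cons[OF p that(1) _ that(4,2,3)] longest[of "M # Es"] by (auto simp: path_def)
  show ?thesis
  proof (cases "vs = []")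
    \<comment> \<open>The longest path is a single edge, so this edge meets no other and any other
      edge serves as \<open>N\<close>.\<close>
    case True
    then have "set Es = {Es ! 0}" using l by (cases Es) auto
    then have "Es ! 0 \<inter> M = {}" if "M \<in> H" "M \<noteq> Es ! 0" for M
      using in_path[of M] that True by auto
    moreover obtain N where "N \<in> H" "N \<noteq> Es ! 0" using two by metis
    ultimately show ?thesis using that[OF E] by blast
  next
    case False
    then have l1: "1 < length Es" using l by simp
    have "Es ! 0 \<inter> M \<subseteq> Es ! 1" if M: "M \<in> H" "M \<noteq> Es ! 0" for M
    proof
      fix x assume x: "x \<in> Es ! 0 \<inter> M"
      show "x \<in> Es ! 1"
      proof (rule ccontr)
        assume nx: "x \<notin> Es ! 1"
        \<comment> \<open>If \<open>x = vs ! k\<close>, then \<open>k\<close> is positive because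
          \<open>vs ! 0\<close> lies in \<open>Es ! 1\<close>; by \<open>no_cycle\<close>,
          \<open>x\<close> would occur again before position \<open>k\<close>, against
          distinctness.\<close>
        have "x \<notin> set vs"
        proof
          assume "x \<in> set vs"
          then obtain k where k: "k < length vs" "x = vs ! k" by (auto simp: in_set_conv_nth)
          then have "0 < k" using nx i[of 0] by (cases k) auto
          then have "x \<in> set (take k vs)" using no_cycle[of k x] k i[of k] x l by auto
          then show False using k s(3) by (auto simp: in_set_conv_nth nth_eq_iff_index_eq)
        qed
        moreover from this have "M \<in> set Es" using in_path M x by blast
        then obtain k where "k < length Es" "M = Es ! k" by (auto simp: in_set_conv_nth)
        moreover from this have "0 < k" using M by (cases k) auto
        ultimately show False using no_cycle[of k x] x by (auto dest: in_set_takeD)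
      qed
    qed
    moreover have "Es ! 1 \<in> H" using s(1) nth_mem[OF l1] by blast
    moreover have "Es ! 1 \<noteq> Es ! 0" using nth_eq_iff_index_eq[OF s(2) l1, of 0] l by simp
    ultimately show ?thesis using that[OF E] by blast
  qed
qed

section \<open>Selecting edges by ranks\<close>

definition rank_below :: "('b \<Rightarrow> nat) \<Rightarrow> nat \<Rightarrow> 'b set \<Rightarrow> 'b set" where
  "rank_below r i N = {x \<in> N. r x \<le> i}"

definition rank_less :: "('b \<Rightarrow> nat) \<Rightarrow> 'b set \<Rightarrow> 'b set \<Rightarrow> bool" where
  "rank_less r L N \<longleftrightarrow> (\<exists>i. rank_below r i N \<subset> rank_below r i L)"

definition rank_minimal :: "('b \<Rightarrow> nat) \<Rightarrow> 'b set set \<Rightarrow> 'b set set" where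
  "rank_minimal r H = {M \<in> H. \<not> (\<exists>N\<in>H. rank_less r N M)}"

lemma rank_below_mono_rank: "i \<le> j \<Longrightarrow> rank_below r i N \<subseteq> rank_below r j N"
  by (auto simp: rank_below_def)

lemma rank_below_cong:
  "(\<And>x. x \<in> N \<Longrightarrow> r x = r' x) \<Longrightarrow> rank_below r i N = rank_below r' i N"
  by (auto simp: rank_below_def)

lemma rank_less_irrefl: "\<not> rank_less r M M"
  by (auto simp: rank_less_def)

text \<open>At the smaller of the two witnessing ranks both inclusions hold, and one of them is
  strict.\<close>

lemma rank_less_trans:
  assumes "rank_less r L M" "rank_less r M N"
  shows "rank_less r L N"
proof -
  obtain i j where "rank_below r i M \<subset> rank_below r i L" "rank_below r j N \<subset> rank_below r j M"
    using assms by (auto simp: rank_less_def)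
  then have "rank_below r (min i j) N \<subset> rank_below r (min i j) L"
    by (cases "i \<le> j") (auto simp: rank_below_def min_def)
  then show ?thesis by (auto simp: rank_less_def)
qed

lemma rank_bound:
  assumes "finite N"
  obtains b :: nat where "\<And>x. x \<in> N \<Longrightarrow> r x \<le> b"
  using assms by (metis Max_ge finite_imageI imageI)

section \<open>Extending a selection by an ear\<close>

context
  fixes H :: "'b set set" and E N' :: "'b set" and r :: "'b \<Rightarrow> nat"
  assumes fin: "finite (\<Union> H)"
    and antichain: "\<And>M N. M \<in> H \<Longrightarrow> N \<in> H \<Longrightarrow> M \<subseteq> N \<Longrightarrow> M = N"
    and E: "E \<in> H" and N': "N' \<in> H" "N' \<noteq> E"
    and ear: "\<And>M. M \<in> H \<Longrightarrow> M \<noteq> E \<Longrightarrow> E \<inter> M \<subseteq> N'"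
begin

private definition upd :: "nat \<Rightarrow> 'b \<Rightarrow> nat" where
  "upd i x = (if x \<in> E - N' then i else r x)"

text \<open>Only vertices of \<open>E - N'\<close> change rank, and the ear property keeps them out
  of every other edge.\<close>

private lemma upd_other: "M \<in> H \<Longrightarrow> M \<noteq> E \<Longrightarrow> rank_below (upd i) j M = rank_below r j M"
  using ear by (intro rank_below_cong) (auto simp: upd_def)

private lemma rank_less_upd_other:
  "M \<in> H \<Longrightarrow> M \<noteq> E \<Longrightarrow> N \<in> H \<Longrightarrow> N \<noteq> E \<Longrightarrow> rank_less (upd i) M N \<longleftrightarrow> rank_less r M N"
  by (simp add: rank_less_def upd_other)

text \<open>Below rank \<open>i\<close> the private vertices do not count yet; what remains of
  \<open>E\<close> lies in \<open>N'\<close> with its old ranks.\<close>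

private lemma rank_below_upd_ear: "j < i \<Longrightarrow> rank_below (upd i) j E \<subseteq> rank_below r j N'"
  by (auto simp: rank_below_def upd_def split: if_splits)

lemma rank_minimal_ear_unwanted: "\<exists>r'. rank_minimal r' H = rank_minimal r (H - {E})"
proof -
  have "finite N'" using fin N' by (meson Union_upper finite_subset)
  then obtain b where b: "\<And>x. x \<in> N' \<Longrightarrow> r x \<le> b" using rank_bound by metis
  \<comment> \<open>Up to rank \<open>b\<close>, all of \<open>N'\<close> counts but only the part
    of \<open>E\<close> inside \<open>N'\<close>.\<close>
  let ?r = "upd (Suc b)"
  have "rank_below ?r b E \<subseteq> E \<inter> N'" using b by (auto simp: rank_below_def upd_def)
  moreover have "rank_below ?r b N' = N'" using b by (auto simp: rank_below_def upd_def)
  moreover have "\<not> N' \<subseteq> E" using antichain E N' by blast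
  ultimately have "rank_below ?r b E \<subset> rank_below ?r b N'" by auto
  then have less: "rank_less ?r N' E" by (auto simp: rank_less_def)
  have "rank_minimal ?r H = rank_minimal r (H - {E})"
  proof (intro equalityI subsetI)
    fix M assume "M \<in> rank_minimal ?r H"
    then show "M \<in> rank_minimal r (H - {E})"
      using less N' rank_less_upd_other unfolding rank_minimal_def by auto
  next
    fix M assume M: "M \<in> rank_minimal r (H - {E})"
    have other: "\<not> rank_less ?r N M" if "N \<in> H" "N \<noteq> E" for N
      using M that rank_less_upd_other by (simp add: rank_minimal_def)
    \<comment> \<open>Whatever \<open>E\<close> beats is also beaten by \<open>N'\<close>, one of
      the other edges.\<close>
    then have "\<not> rank_less ?r E M" using rank_less_trans[OF less] N' by blast
    with other M show "M \<in> rank_minimal ?r H" by (auto simp: rank_minimal_def)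
  qed
  then show ?thesis by blast
qed

lemma rank_minimal_ear_wanted:
  "\<exists>r'. rank_minimal r' H = insert E (rank_minimal r (H - {E}))"
proof -
  let ?S = "rank_minimal r (H - {E})"
  define escaped where "escaped i \<longleftrightarrow> (\<forall>N\<in>?S. \<not> rank_below r i N \<subseteq> E)" for i
  have S: "N \<in> H" "N \<noteq> E" "\<not> N \<subseteq> E" if "N \<in> ?S" for N
    using that antichain E by (auto simp: rank_minimal_def)
  obtain b where b: "\<And>x. x \<in> \<Union> H \<Longrightarrow> r x \<le> b" using rank_bound[OF fin] by metis
  \<comment> \<open>At rank \<open>b\<close> every vertex counts, so the antichain property yields
    \<open>escaped b\<close> and the least such rank exists.\<close>
  have "rank_below r b N = N" if "N \<in> ?S" for N
    using b S(1)[OF that] by (auto simp: rank_below_def)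
  then have "escaped b" using S by (auto simp: escaped_def)
  then have i: "escaped (Least escaped)" by (rule LeastI)
  define i where "i = Least escaped"
  let ?r = "upd i"
  \<comment> \<open>A private vertex; from its new rank \<open>i\<close> on, it stops any other edge
    from covering \<open>E\<close>.\<close>
  obtain q where q: "q \<in> E" "q \<notin> N'" using antichain E N' by blast
  have "\<not> rank_less ?r N E" if N: "N \<in> H" for N
  proof
    assume "rank_less ?r N E"
    then obtain j where j: "rank_below ?r j E \<subset> rank_below ?r j N" by (auto simp: rank_less_def)
    then have "N \<noteq> E" by auto
    then have "q \<notin> N" using ear N q by blast
    then have "q \<notin> rank_below ?r j E" using j by (auto simp: rank_below_def)
    then have "j < i" using q by (auto simp: rank_below_def upd_def)
    then have "\<not> escaped j" unfolding i_def by (rule not_less_Least)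
    \<comment> \<open>The part of \<open>M\<close> up to rank \<open>j\<close> lies within that of
      \<open>E\<close>, so an edge beating \<open>E\<close> at \<open>j\<close> also beats the
      selected \<open>M\<close>, which is minimal.\<close>
    then obtain M where M: "M \<in> ?S" "rank_below r j M \<subseteq> E" by (auto simp: escaped_def)
    then have "rank_below ?r j M \<subseteq> E" using S upd_other by simp
    then have "rank_below ?r j M \<subseteq> rank_below ?r j E" by (auto simp: rank_below_def)
    from subset_psubset_trans[OF this j] have "rank_less ?r N M" unfolding rank_less_def ..
    then have "rank_less r N M"
      using N \<open>N \<noteq> E\<close> S(1,2)[OF M(1)] rank_less_upd_other by blast
    then show False using M(1) N \<open>N \<noteq> E\<close> unfolding rank_minimal_def by blast
  qed
  moreover have "\<not> rank_less ?r E M" if M: "M \<in> ?S" for M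
  proof
    assume "rank_less ?r E M"
    then obtain j where j: "rank_below r j M \<subset> rank_below ?r j E"
      unfolding rank_less_def upd_other[OF S(1,2)[OF M]] ..
    \<comment> \<open>At rank \<open>i\<close> the edge \<open>M\<close> has a vertex outside
      \<open>E\<close>, while up to \<open>j\<close> it lies inside; hence \<open>j < i\<close>,
      where \<open>N'\<close> covers the counted part of \<open>E\<close> and so beats
      \<open>M\<close> too.\<close>
    then have "\<not> rank_below r i M \<subseteq> rank_below r j M"
      using i M unfolding escaped_def i_def rank_below_def by blast
    then have "j < i" using rank_below_mono_rank[of i j r M] by linarith
    from psubset_subset_trans[OF j rank_below_upd_ear[OF this]]
    have "rank_less r N' M" unfolding rank_less_def ..
    then show False using M N' unfolding rank_minimal_def by blast
  qed
  moreover have "M \<in> ?S" if "M \<in> rank_minimal ?r H" "M \<noteq> E" for M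
    using that rank_less_upd_other[of _ M i] unfolding rank_minimal_def by blast
  moreover have "\<not> rank_less ?r N M" if "M \<in> ?S" "N \<in> H" "N \<noteq> E" for M N
    using that rank_less_upd_other[of N M i] unfolding rank_minimal_def by blast
  ultimately have "rank_minimal ?r H = insert E ?S"
    using E S(1) unfolding rank_minimal_def[of ?r H] by (intro equalityI subsetI) blast+
  then show ?thesis by blast
qed

end

section \<open>Induction by removing ears\<close>

lemma rank_minimal_single:
  fixes H :: "'b set set"
  assumes "E \<in> H" and antichain: "\<And>N. N \<in> H \<Longrightarrow> E \<subseteq> N \<Longrightarrow> E = N"
  shows "\<exists>r. rank_minimal r H = {E}"
proof -
  \<comment> \<open>At rank 0 all of \<open>E\<close> counts, but only a proper part of it in any
    other edge.\<close>
  define r :: "'b \<Rightarrow> nat" where "r x = (if x \<in> E then 0 else 1)" for x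
  have less: "rank_less r E N" if "N \<in> H" "N \<noteq> E" for N
  proof -
    have "rank_below r 0 N \<subset> rank_below r 0 E"
      using antichain[of N] that by (auto simp: rank_below_def r_def)
    then show ?thesis by (auto simp: rank_less_def)
  qed
  then have "\<not> rank_less r N E" if "N \<in> H" for N
    using that rank_less_trans rank_less_irrefl by metis
  then have "rank_minimal r H = {E}" using less assms(1) by (auto simp: rank_minimal_def)
  then show ?thesis by blast
qed

lemma berge_acyclic_rank_minimal:
  assumes "finite H" "finite (\<Union> H)" "berge_acyclic H"
    and "\<And>M N. M \<in> H \<Longrightarrow> N \<in> H \<Longrightarrow> M \<subseteq> N \<Longrightarrow> M = N"
    and "S \<subseteq> H" "S \<noteq> {}"
  shows "\<exists>r. rank_minimal r H = S"
  using assms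
proof (induction "card H" arbitrary: H S rule: less_induct)
  case less
  show ?case
  proof (cases "\<exists>E. S = {E}")
    \<comment> \<open>Singletons are treated apart: removing their edge as an ear would leave an
      empty selection, outside the induction hypothesis.\<close>
    case True
    then show ?thesis using rank_minimal_single less.prems by (metis insert_subset)
  next
    case False
    then obtain A B where "A \<in> H" "B \<in> H" "A \<noteq> B"
      using less.prems(5,6) by (metis all_not_in_conv singletonI subsetD subset_singletonD subsetI)
    then obtain E N' where ear: "E \<in> H" "N' \<in> H" "N' \<noteq> E"
      "\<And>M. M \<in> H \<Longrightarrow> M \<noteq> E \<Longrightarrow> E \<inter> M \<subseteq> N'"
      using berge_acyclic_ear less.prems(1,3) by metis
    have "card (H - {E}) < card H" using ear(1) less.prems(1) by (meson card_Diff1_less)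
    moreover have "finite (\<Union> (H - {E}))"
      using less.prems(2) by (rule finite_subset[rotated]) auto
    moreover have "S - {E} \<noteq> {}" using False less.prems(6) by blast
    ultimately obtain r where r: "rank_minimal r (H - {E}) = S - {E}"
      using less.hyps[of "H - {E}" "S - {E}"] less.prems
        berge_acyclic_subset[OF less.prems(3), of "H - {E}"]
      by (auto 4 4)
    show ?thesis
    proof (cases "E \<in> S")
      case True
      with rank_minimal_ear_wanted[OF less.prems(2,4) ear, of r] r show ?thesis by (simp add: insert_absorb)
    next
      case False
      with rank_minimal_ear_unwanted[OF less.prems(2,4) ear, of r] r show ?thesis by simp
    qed
  qed
qed

section \<open>Priority orderings from ranks\<close>

lemma prio_less_Nil: "\<not> prio_less [] L N"
  by (simp add: prio_less_def)

lemma prio_less_Cons: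
  "prio_less (X # P) L N \<longleftrightarrow> X \<inter> N \<subset> X \<inter> L \<or> X \<inter> L = X \<inter> N \<and> prio_less P L N"
  unfolding prio_less_def by (auto simp: Ex_less_Suc2 All_less_Suc2)

lemma prio_less_filter_nonempty:
  "prio_less (filter (\<lambda>X. X \<noteq> {}) P) L N \<longleftrightarrow> prio_less P L N"
  by (induction P) (auto simp: prio_less_Nil prio_less_Cons)

text \<open>An inclusion up to rank \<open>i\<close> restricts to every lower rank. So at the least
  rank where it is strict, the sets agree on all lower classes and differ in class \<open>i\<close>
  itself.\<close>

lemma prio_less_rank_classes:
  assumes "L \<subseteq> V" "N \<subseteq> V" and n: "\<And>x. x \<in> V \<Longrightarrow> r x < n"
  shows "prio_less (map (\<lambda>i. {x \<in> V. r x = i}) [0..<n]) L N \<longleftrightarrow> rank_less r L N"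
    (is "prio_less ?P L N \<longleftrightarrow> _")
proof
  assume "prio_less ?P L N"
  then obtain i where i: "i < length ?P" "\<forall>j<i. ?P ! j \<inter> L = ?P ! j \<inter> N"
    "?P ! i \<inter> N \<subset> ?P ! i \<inter> L"
    unfolding prio_less_def by blast
  have nth: "?P ! j = {x \<in> V. r x = j}" if "j \<le> i" for j using that i(1) by simp
  have below: "?P ! j \<inter> L = ?P ! j \<inter> N" if "j < i" for j using i(2) that by blast
  have "x \<in> L \<longleftrightarrow> x \<in> N" if "r x < i" for x
  proof -
    have "{y \<in> V. r y = r x} \<inter> L = {y \<in> V. r y = r x} \<inter> N"
      using below[OF that] unfolding nth[OF less_imp_le[OF that]] .
    then show ?thesis using assms(1,2) by auto
  qed
  then have "rank_below r i N \<subset> rank_below r i L"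
    using i(3) assms(1,2) unfolding nth[OF order_refl] by (auto simp: rank_below_def le_less)
  then show "rank_less r L N" by (auto simp: rank_less_def)
next
  assume "rank_less r L N"
  then obtain i where i: "rank_below r i N \<subset> rank_below r i L"
    and least: "\<And>j. j < i \<Longrightarrow> \<not> rank_below r j N \<subset> rank_below r j L"
    unfolding rank_less_def exists_least_iff[of "\<lambda>i. rank_below r i N \<subset> rank_below r i L"]
    by blast
  have eq: "x \<in> L \<longleftrightarrow> x \<in> N" if "r x < i" for x
  proof -
    have "rank_below r (r x) N = rank_below r (r x) L"
      using i least[OF that] that by (auto simp: rank_below_def)
    then show ?thesis by (auto simp: rank_below_def)
  qed
  obtain y where y: "y \<in> L" "y \<notin> N" "r y \<le> i" using i by (auto simp: rank_below_def)
  then have "r y = i" using eq[of y] by (auto simp: le_less)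
  moreover from this have "i < n" using n y assms(1) by blast
  ultimately show "prio_less ?P L N"
    using i eq y assms(1,2) unfolding prio_less_def
    by (intro exI[of _ i]) (auto simp: rank_below_def)
qed

lemma priority_ordering_rank_classes:
  assumes "\<And>x. x \<in> V \<Longrightarrow> r x < n"
  shows "priority_ordering V (filter (\<lambda>X. X \<noteq> {}) (map (\<lambda>i. {x \<in> V. r x = i}) [0..<n]))"
proof -
  \<comment> \<open>A nonempty class determines its rank, so no class is listed twice.\<close>
  have "inj_on (\<lambda>i. {x \<in> V. r x = i}) {i. {x \<in> V. r x = i} \<noteq> {}}"
    by (rule inj_onI) blast
  then have "distinct (filter (\<lambda>X. X \<noteq> {}) (map (\<lambda>i. {x \<in> V. r x = i}) [0..<n]))"
    unfolding filter_map distinct_map by (auto elim: inj_on_subset)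
  then show ?thesis
    unfolding priority_ordering_def partition_on_def disjoint_def
    using assms by fastforce
qed

theorem theorem6:
  fixes K :: "nat \<Rightarrow> 'a form" and m :: nat
  assumes "\<forall>i\<in>{1..m}. consistent {K i}"
    and "berge_acyclic (maxsets (K ` {1..m}))"
  shows "\<forall>S. S \<subseteq> maxsets (K ` {1..m}) \<and> S \<noteq> {} \<longrightarrow>
             obtainable (K ` {1..m}) (disj_maxsets S)"
proof (intro allI impI, elim conjE)
  fix S assume S: "S \<subseteq> maxsets (K ` {1..m})" "S \<noteq> {}"
  let ?V = "K ` {1..m}"
  have sub: "M \<subseteq> ?V" if "M \<in> maxsets ?V" for M
    using that by (simp add: maxsets_def)
  then have "maxsets ?V \<subseteq> Pow ?V" "\<Union> (maxsets ?V) \<subseteq> ?V" by blast+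
  from this[THEN finite_subset]
  have fin: "finite (maxsets ?V)" "finite (\<Union> (maxsets ?V))" by simp_all
  have "M = N" if "M \<in> maxsets ?V" "N \<in> maxsets ?V" "M \<subseteq> N" for M N
    using that by (simp add: maxsets_def)
  with berge_acyclic_rank_minimal[OF fin assms(2) _ S]
  obtain r where r: "rank_minimal r (maxsets ?V) = S" by blast
  obtain b where "\<And>x. x \<in> ?V \<Longrightarrow> r x \<le> b" using rank_bound[of ?V r] by blast
  then have b: "r x < Suc b" if "x \<in> ?V" for x using that by (simp add: le_imp_less_Suc)
  let ?P = "filter (\<lambda>X. X \<noteq> {}) (map (\<lambda>i. {x \<in> ?V. r x = i}) [0..<Suc b])"
  have "prio_less ?P L N \<longleftrightarrow> rank_less r L N" if "L \<in> maxsets ?V" "N \<in> maxsets ?V" for L N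
    unfolding prio_less_filter_nonempty
    by (rule prio_less_rank_classes[OF sub[OF that(1)] sub[OF that(2)] b])
  \<comment> \<open>The minimal maxsets are exactly \<open>S\<close>, so the two disjunctions are
    the same formula.\<close>
  then have "{M \<in> maxsets ?V. \<not> (\<exists>N\<in>maxsets ?V. prio_less ?P N M)} = S"
    using r unfolding rank_minimal_def by blast
  then have "equivalent (disj_maxsets S) (merge ?V ?P)"
    by (simp add: merge_def equivalent_def)
  moreover have "priority_ordering ?V ?P" by (rule priority_ordering_rank_classes[OF b])
  ultimately show "obtainable ?V (disj_maxsets S)" by (auto simp only: obtainable_def)
qed

end
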